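(* In the game Mines$_3$, player one has a winning strategy: player one can play so that, whatever player two does, at some point the set $X$ of positions marked by player one contains an element of $\triangle_2(B)$.
   Context: $T_n=n(n+1)/2$, $T_0=0$. A finite set $X\subseteq\mathbb{N}$ with $|X|=T_n$, enumerated $x_1<\dots<x_{T_n}$, has $i$-th level $\{x_{T_{i-1}+1},\dots,x_{T_i}\}$ for $1\le i\le n$; $\triangle_n$ is the set of all $X\subseteq\mathbb{N}$ with $|X|=T_n$. For such sets, $X\le Y$ means $X\subseteq Y$ and every level of $X$ is contained in a single level of $Y$, distinct levels of $X$ being contained in distinct levels of $Y$; $\triangle_k(B)=\{Z\in\triangle_k:Z\le B\}$. Mines$_3$ is played on the board $B=\{1,\dots,6\}\in\triangle_3$ by two players who alternate turns, player one moving first; on each turn a player either marks one not-yet-marked position of $B$ with his own mark or passes. The game ends when all positions are marked. With $X$, $Y$ the sets of positions marked by players one and two, player one wins if $X$ contains an element of $\triangle_2(B)$, and player two wins if $Y$ contains an element of $\triangle_2(B)$. *)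

theory Defs
  imports Main
begin

definition tri :: "nat \<Rightarrow> nat" where
  "tri n = n * (n + 1) div 2"

definition triangles :: "nat \<Rightarrow> nat set set" where
  "triangles n = {X. finite X \<and> card X = tri n}"

text \<open>
  List positions start at 0, so the elements \<open>x\<^sub>m\<close> with \<open>tri (i - 1) + 1 \<le> m \<le> tri i\<close>
  sit at the positions \<open>{tri (i - 1)..<tri i}\<close>. Meaningful for \<open>X \<in> triangles n\<close> and
  \<open>1 \<le> i \<le> n\<close> only.
\<close>

definition level :: "nat set \<Rightarrow> nat \<Rightarrow> nat set" where
  "level X i = (\<lambda>m. sorted_list_of_set X ! m) ` {tri (i - 1)..<tri i}"

text \<open>
  The sizes \<open>k\<close> and \<open>n\<close> are determined by \<open>X\<close> and \<open>Y\<close>, since \<open>tri\<close> is injective.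
  The map \<open>f\<close> sends each level of \<open>X\<close> to the level of \<open>Y\<close> that contains it.
\<close>

definition tri_le :: "nat set \<Rightarrow> nat set \<Rightarrow> bool" where
  "tri_le X Y \<longleftrightarrow>
     (\<exists>k n. X \<in> triangles k \<and> Y \<in> triangles n \<and> X \<subseteq> Y \<and>
        (\<exists>f. inj_on f {1..k} \<and> f ` {1..k} \<subseteq> {1..n} \<and>
             (\<forall>i\<in>{1..k}. level X i \<subseteq> level Y (f i))))"

definition triangles_below :: "nat \<Rightarrow> nat set \<Rightarrow> nat set set" where
  "triangles_below k B = {Z \<in> triangles k. tri_le Z B}"

datatype player = One | Two

text \<open>A move is \<open>Some b\<close> (mark position \<open>b\<close>) or \<open>None\<close> (pass); a history lists the moves
  of both players in chronological order.\<close>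

type_synonym move = "nat option"
type_synonym history = "move list"

definition to_move :: "history \<Rightarrow> player" where
  "to_move h = (if even (length h) then One else Two)"

definition marked_by :: "player \<Rightarrow> history \<Rightarrow> nat set" where
  "marked_by P h = {b. \<exists>t<length h. to_move (take t h) = P \<and> h ! t = Some b}"

definition legal_move :: "nat set \<Rightarrow> history \<Rightarrow> move \<Rightarrow> bool" where
  "legal_move B h m \<longleftrightarrow>
     (case m of None \<Rightarrow> True
      | Some b \<Rightarrow> b \<in> B \<and> b \<notin> marked_by One h \<and> b \<notin> marked_by Two h)"

definition legal_history :: "nat set \<Rightarrow> history \<Rightarrow> bool" where
  "legal_history B h \<longleftrightarrow> (\<forall>t<length h. legal_move B (take t h) (h ! t))"

text \<open>
  Since passing is always allowed, a play need not be finite, and plays are modelled as infinite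
  sequences of moves. Once all positions of the board are marked, passing is the only legal move
  and the marked sets no longer change; the end of the game is thus represented by a
  tail of passes.
\<close>

definition hist :: "(nat \<Rightarrow> move) \<Rightarrow> nat \<Rightarrow> history" where
  "hist p t = map p [0..<t]"

definition legal_play :: "nat set \<Rightarrow> (nat \<Rightarrow> move) \<Rightarrow> bool" where
  "legal_play B p \<longleftrightarrow> (\<forall>t. legal_move B (hist p t) (p t))"

definition strategy :: "nat set \<Rightarrow> player \<Rightarrow> (history \<Rightarrow> move) \<Rightarrow> bool" where
  "strategy B P \<sigma> \<longleftrightarrow>
     (\<forall>h. legal_history B h \<and> to_move h = P \<longrightarrow> legal_move B h (\<sigma> h))"

definition follows :: "player \<Rightarrow> (history \<Rightarrow> move) \<Rightarrow> (nat \<Rightarrow> move) \<Rightarrow> bool" where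
  "follows P \<sigma> p \<longleftrightarrow> (\<forall>t. to_move (hist p t) = P \<longrightarrow> p t = \<sigma> (hist p t))"

definition wins :: "nat set \<Rightarrow> nat \<Rightarrow> player \<Rightarrow> history \<Rightarrow> bool" where
  "wins B k P h \<longleftrightarrow> (\<exists>Z\<in>triangles_below k B. Z \<subseteq> marked_by P h)"

definition winning_strategy ::
    "nat set \<Rightarrow> nat \<Rightarrow> player \<Rightarrow> (history \<Rightarrow> move) \<Rightarrow> bool" where
  "winning_strategy B k P \<sigma> \<longleftrightarrow>
     strategy B P \<sigma> \<and>
     (\<forall>p. legal_play B p \<and> follows P \<sigma> p \<longrightarrow> (\<exists>t. wins B k P (hist p t)))"

end

theory Submission
  imports Defs
begin

text \<open>
  The levels of the board are \<open>{1}\<close>, \<open>{2, 3}\<close>, \<open>{4, 5, 6}\<close>, so two positions of the last level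
  and one of \<open>1, 2, 3\<close> always form a winning triangle. Player one takes 4, then 5 or 6, then
  any free one of \<open>1, 2, 3\<close>: before the second of these moves player two has marked at most one
  position, before the third at most two, so a choice is always available.
\<close>

lemma sorted_list_of_board: "sorted_list_of_set {1..6::nat} = [1, 2, 3, 4, 5, 6]"
proof -
  have "{1..6::nat} = set [1, 2, 3, 4, 5, 6]"
    by auto
  then show ?thesis
    by (simp only: sorted_list_of_set_sort_remdups) simp
qed

lemma level_board:
  "level {1..6} (Suc 0) = {1}" "level {1..6} 2 = {2, 3}" "level {1..6} 3 = {4, 5, 6}"
proof -
  have "{0..<1} = {0::nat}" "{1..<3} = {1, 2::nat}" "{3..<6} = {3, 4, 5::nat}"
    by auto
  then show "level {1..6} (Suc 0) = {1}" "level {1..6} 2 = {2, 3}" "level {1..6} 3 = {4, 5, 6}"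
    unfolding level_def sorted_list_of_board by (simp_all add: tri_def)
qed

lemma level_three:
  assumes "a < b" "b < c"
  shows "level {a, b, c} (Suc 0) = {a}" "level {a, b, c} 2 = {b, c}"
proof -
  have "sorted_list_of_set {a, b, c} = [a, b, c]"
    using assms by (simp add: sorted_list_of_set_insert_remove)
  moreover have "{0..<1} = {0::nat}" "{1..<3} = {1, 2::nat}"
    by auto
  ultimately show "level {a, b, c} (Suc 0) = {a}" "level {a, b, c} 2 = {b, c}"
    unfolding level_def by (simp_all add: tri_def)
qed

lemma winning_triangle:
  assumes a: "a \<in> {1, 2, 3}" and b: "b \<in> {5, 6}"
  shows "{a, 4, b} \<in> triangles_below 2 {1..6}"
proof -
  \<comment> \<open>As \<open>a < 4 < b\<close>, the levels of the triangle are \<open>{a}\<close>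
    and \<open>{4, b}\<close>. The second lies in board level 3, the first in level 1 or 2 according
    to whether \<open>a = 1\<close>.\<close>
  define f :: "nat \<Rightarrow> nat" where
    "f i = (if i = 2 then 3 else if a = 1 then 1 else 2)" for i
  have lt: "a < 4" "4 < b"
    using a b by auto
  have ones: "{1..2} = {Suc 0, 2}"
    by auto
  have "inj_on f {1..2}" "f ` {1..2} \<subseteq> {1..3}"
    unfolding ones by (auto simp: f_def)
  moreover have "\<forall>i\<in>{1..2}. level {a, 4, b} i \<subseteq> level {1..6} (f i)"
    unfolding ones using a b by (auto simp: f_def level_three[OF lt] level_board[unfolded One_nat_def])
  moreover have tr: "{a, 4, b} \<in> triangles 2"
    using lt by (simp add: triangles_def tri_def)
  moreover have "{1..6} \<in> triangles 3"
    by (simp add: triangles_def tri_def)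
  moreover have "{a, 4, b} \<subseteq> {1..6}"
    using a b by auto
  ultimately show ?thesis
    unfolding triangles_below_def tri_le_def by blast
qed

text \<open>Here \<open>t\<close> counts the moves of both players, so player one moves at the even
  times; the bounds 2 and 4 separate the turns at times 0, 2 and 4.\<close>

definition target :: "nat \<Rightarrow> nat set" where
  "target t = (if t < 2 then {4} else if t < 4 then {5, 6} else {1, 2, 3})"

definition free_targets :: "history \<Rightarrow> nat set" where
  "free_targets h = target (length h) - marked_by One h - marked_by Two h"

text \<open>Passing when no target is free keeps the move legal on every history: late in a play,
  and also after player one has deviated.\<close>

definition target_strategy :: "history \<Rightarrow> move" where
  "target_strategy h =
     (if free_targets h = {} then None else Some (SOME b. b \<in> free_targets h))"

lemma target_strategy_cases:
  obtains "free_targets h = {}" "target_strategy h = None"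
  | b where "b \<in> free_targets h" "target_strategy h = Some b"
  by (metis (mono_tags) ex_in_conv someI target_strategy_def)

lemma strategy_target_strategy: "strategy {1..6} P target_strategy"
proof -
  have "legal_move {1..6} h (target_strategy h)" for h
    by (cases h rule: target_strategy_cases)
      (auto simp: legal_move_def free_targets_def target_def split: if_splits)
  then show ?thesis
    by (simp add: strategy_def)
qed

lemma to_move_hist: "to_move (hist p t) = (if even t then One else Two)"
  by (simp add: to_move_def hist_def)

lemma take_hist: "s \<le> t \<Longrightarrow> take s (hist p t) = hist p s"
  by (simp add: hist_def take_map)

lemma marked_by_hist:
  "marked_by One (hist p t) = {b. \<exists>s<t. even s \<and> p s = Some b}"
  "marked_by Two (hist p t) = {b. \<exists>s<t. odd s \<and> p s = Some b}"
proof -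
  have "length (hist p t) = t" "\<And>s. s < t \<Longrightarrow> hist p t ! s = p s"
    by (auto simp: hist_def)
  then show "marked_by One (hist p t) = {b. \<exists>s<t. even s \<and> p s = Some b}"
    "marked_by Two (hist p t) = {b. \<exists>s<t. odd s \<and> p s = Some b}"
    unfolding marked_by_def
    by (auto simp: take_hist to_move_hist split: if_splits)
qed

text \<open>Each earlier turn belongs to one of the two players, so removing both sets of marks
  excludes the moves at all times \<open>s < t\<close>.\<close>

lemma free_targets_hist: "free_targets (hist p t) = {b \<in> target t. \<forall>s<t. p s \<noteq> Some b}"
  by (auto simp: free_targets_def marked_by_hist) (simp_all add: hist_def)

text \<open>The position \<open>b\<close> only witnesses that some target is free, so that the
  strategy does not pass; the position \<open>c\<close> actually marked may differ from
  \<open>b\<close>.\<close>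

lemma follows_target_strategy:
  assumes "follows One target_strategy p" "even t" "b \<in> target t" "\<forall>s<t. p s \<noteq> Some b"
  obtains c where "c \<in> target t" "p t = Some c"
proof -
  have "p t = target_strategy (hist p t)"
    using assms(1,2) by (simp add: follows_def to_move_hist)
  moreover have "b \<in> free_targets (hist p t)"
    using assms(3,4) by (simp add: free_targets_hist)
  ultimately show thesis
    using that by (cases "hist p t" rule: target_strategy_cases) (auto simp: free_targets_hist)
qed

theorem theorem4:
  "\<exists>\<sigma>. winning_strategy {1..6} 2 One \<sigma>"
proof -
  \<comment> \<open>Length 5 covers the times 0 to 4: three moves of player one, with replies at
    times 1 and 3.\<close>
  have "wins {1..6} 2 One (hist p 5)" if p: "follows One target_strategy p" for p
  proof -
    have p0: "p 0 = Some 4"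
      by (rule follows_target_strategy[OF p, of 0 4]) (auto simp: target_def)
    have "\<exists>b\<in>{5, 6}. p 1 \<noteq> Some b"
      by auto
    then obtain b' where b': "b' \<in> {5, 6}" "p 1 \<noteq> Some b'"
      by blast
    then have "\<forall>s<2. p s \<noteq> Some b'"
      using p0 by (auto dest!: less_2_cases)
    then obtain b where b: "b \<in> {5, 6}" "p 2 = Some b"
      using follows_target_strategy[OF p, of 2 b'] b'(1) by (auto simp: target_def)
    have "\<exists>a\<in>{1, 2, 3}. p 1 \<noteq> Some a \<and> p 3 \<noteq> Some a"
      by auto
    then obtain a where a: "a \<in> {1, 2, 3}" "p 1 \<noteq> Some a" "p 3 \<noteq> Some a"
      by blast
    have "s = 0 \<or> s = 1 \<or> s = 2 \<or> s = 3" if "s < 4" for s :: nat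
      using that by linarith
    \<comment> \<open>At times 0 and 2 player one marked 4 and \<open>b\<close>, both greater than
      \<open>a\<close>; the replies at times 1 and 3 avoid \<open>a\<close> by its choice.\<close>
    then have "\<forall>s<4. p s \<noteq> Some a"
      using p0 a b by fastforce
    then obtain c where c: "c \<in> {1, 2, 3}" "p 4 = Some c"
      using follows_target_strategy[OF p, of 4 a] a(1) by (auto simp: target_def)
    have "\<exists>s<5. even s \<and> p s = Some c" "\<exists>s<5. even s \<and> p s = Some 4"
      "\<exists>s<5. even s \<and> p s = Some b"
      using p0 b c by (auto intro: exI[of _ 4] exI[of _ 0] exI[of _ 2])
    then have "{c, 4, b} \<subseteq> marked_by One (hist p 5)"
      by (simp add: marked_by_hist)
    then show ?thesis
      using winning_triangle[OF c(1) b(1)] unfolding wins_def by blast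
  qed
  then show ?thesis
    using strategy_target_strategy unfolding winning_strategy_def by blast
qed

end
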